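(* Let $d\ge 2$ be an integer, and let $V_d=\nu_d(\mathbb{P}^2)\subset\mathbb{P}^{N_d}$, $N_d=\binom{d+2}{2}-1$, be the $d$-th Veronese surface. The second osculating variety $\tau_2(V_d)$ is contained in the secant variety $\sigma_4(V_d)$. Thus every $T\in\tau_2(V_d)$ has border rank $\le 4$.
   Context: Everything is over $\mathbb{C}$; $\nu_d$ is the $d$-th Veronese embedding of $\mathbb{P}^2$. For a smooth variety $X\subset\mathbb{P}^N$ and $p\in X$, $\tau_{k,p}(X)=\langle X\cap (k+1)p\rangle$ is the linear span of the $k$-th infinitesimal neighborhood of $p$ in $X$, where $(k+1)p$ is the scheme defined by the $(k+1)$-th power of the ideal of $p$; the $k$-th osculating variety is $\tau_k(X)=\overline{\bigcup_{p\in X}\tau_{k,p}(X)}$. For $k\geq 1$, $\sigma^0_k(X)$ is the union of the linear spans $\langle P_1,\dots,P_k\rangle$ over all sets of $k$ distinct points of $X$, and $\sigma_k(X)=\overline{\sigma_k^0(X)}$. The border rank of $T\in\mathbb{P}^{N_d}$ (with respect to $V_d$) is $\min\{k : T\in\sigma_k(V_d)\}$. Closures are Zariski closures. *)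

theory Defs
  imports "HOL-Library.Poly_Mapping" "HOL-Algebra.Ideal_Product" Complex_Main
begin

section \<open>Polynomials over the complex numbers\<close>

text \<open>
  A polynomial in variables of type \<open>'i\<close> is a finitely supported map from exponent vectors
  to coefficients.  The ambient projective space depends on \<open>d\<close>, so its coordinates are
  indexed by a finite set \<open>I\<close> rather than by a type.
\<close>

type_synonym 'i mpoly = "('i \<Rightarrow>\<^sub>0 nat) \<Rightarrow>\<^sub>0 complex"

definition mdeg :: "('i \<Rightarrow>\<^sub>0 nat) \<Rightarrow> nat" where
  "mdeg \<alpha> = (\<Sum>i\<in>Poly_Mapping.keys \<alpha>. Poly_Mapping.lookup \<alpha> i)"

definition monomials :: "'i set \<Rightarrow> nat \<Rightarrow> ('i \<Rightarrow>\<^sub>0 nat) set" where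
  "monomials I d = {\<alpha>. Poly_Mapping.keys \<alpha> \<subseteq> I \<and> mdeg \<alpha> = d}"

definition meval :: "('i \<Rightarrow>\<^sub>0 nat) \<Rightarrow> ('i \<Rightarrow> complex) \<Rightarrow> complex" where
  "meval \<alpha> v = (\<Prod>i\<in>Poly_Mapping.keys \<alpha>. v i ^ Poly_Mapping.lookup \<alpha> i)"

definition peval :: "'i mpoly \<Rightarrow> ('i \<Rightarrow> complex) \<Rightarrow> complex" where
  "peval f v = (\<Sum>\<alpha>\<in>Poly_Mapping.keys f. Poly_Mapping.lookup f \<alpha> * meval \<alpha> v)"

definition poly_ring :: "'i set \<Rightarrow> 'i mpoly ring" where
  "poly_ring I = \<lparr>carrier = {f. \<forall>\<alpha>\<in>Poly_Mapping.keys f. Poly_Mapping.keys \<alpha> \<subseteq> I},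
     monoid.mult = (*), one = 1, zero = 0, add = (+)\<rparr>"

definition forms :: "'i set \<Rightarrow> nat \<Rightarrow> 'i mpoly set" where
  "forms I n = {f. Poly_Mapping.keys f \<subseteq> monomials I n}"

lemma forms_subset_carrier: "forms I n \<subseteq> carrier (poly_ring I)"
  by (auto simp: forms_def monomials_def poly_ring_def)

lemma cring_poly_ring: "cring (poly_ring I)"
proof (rule cringI)
  have cl: "f + g \<in> carrier (poly_ring I)" "f * g \<in> carrier (poly_ring I)"
    "- f \<in> carrier (poly_ring I)"
    if "f \<in> carrier (poly_ring I)" "g \<in> carrier (poly_ring I)" for f g
  proof -
    show "f + g \<in> carrier (poly_ring I)"
      using that keys_add[of f g] by (auto simp: poly_ring_def)
    show "- f \<in> carrier (poly_ring I)"
      using that by (auto simp: poly_ring_def)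
    have "Poly_Mapping.keys \<alpha> \<subseteq> I" if "\<alpha> \<in> Poly_Mapping.keys (f * g)" for \<alpha>
    proof -
      obtain a b where "\<alpha> = a + b" "a \<in> Poly_Mapping.keys f" "b \<in> Poly_Mapping.keys g"
        using \<open>\<alpha> \<in> Poly_Mapping.keys (f * g)\<close> keys_mult[of f g] by blast
      then show ?thesis
        using \<open>f \<in> _\<close> \<open>g \<in> _\<close> keys_add[of a b] by (fastforce simp: poly_ring_def)
    qed
    then show "f * g \<in> carrier (poly_ring I)"
      by (auto simp: poly_ring_def)
  qed
  have ops: "f \<oplus>\<^bsub>poly_ring I\<^esub> g = f + g" "f \<otimes>\<^bsub>poly_ring I\<^esub> g = f * g"
    "\<zero>\<^bsub>poly_ring I\<^esub> = 0" "\<one>\<^bsub>poly_ring I\<^esub> = 1" for f g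
    by (simp_all add: poly_ring_def)
  have cl0: "0 \<in> carrier (poly_ring I)" "1 \<in> carrier (poly_ring I)"
    by (simp_all add: poly_ring_def)
  show "abelian_group (poly_ring I)"
  proof (rule abelian_groupI)
    fix x assume x: "x \<in> carrier (poly_ring I)"
    show "\<exists>y\<in>carrier (poly_ring I). y \<oplus>\<^bsub>poly_ring I\<^esub> x = \<zero>\<^bsub>poly_ring I\<^esub>"
      using cl(3)[OF x x] by (intro bexI[of _ "- x"]) (simp_all add: ops)
  qed (auto simp: ops algebra_simps intro: cl cl0)
  show "Group.comm_monoid (poly_ring I)"
    by (rule comm_monoidI) (auto simp: ops algebra_simps intro: cl cl0)
qed (auto simp: poly_ring_def algebra_simps)


section \<open>Projective spaces and the Zariski topology\<close>

text \<open>
  The projective space with homogeneous coordinates indexed by \<open>I\<close> has dimension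
  \<open>card I - 1\<close>.  A point is the set of all its homogeneous coordinate vectors; these
  vanish outside \<open>I\<close>.
\<close>

definition point :: "('i \<Rightarrow> complex) \<Rightarrow> ('i \<Rightarrow> complex) set" where
  "point v = {(\<lambda>i. c * v i) | c. c \<noteq> 0}"

definition proj_space :: "'i set \<Rightarrow> ('i \<Rightarrow> complex) set set" where
  "proj_space I = point ` {v. (\<forall>i. i \<notin> I \<longrightarrow> v i = 0) \<and> (\<exists>i. v i \<noteq> 0)}"

definition vanishes :: "'i mpoly \<Rightarrow> ('i \<Rightarrow> complex) set \<Rightarrow> bool" where
  "vanishes f p \<longleftrightarrow> (\<forall>v\<in>p. peval f v = 0)"

definition zero_locus :: "'i set \<Rightarrow> 'i mpoly set \<Rightarrow> ('i \<Rightarrow> complex) set set" where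
  "zero_locus I A = {p \<in> proj_space I. \<forall>f\<in>A. vanishes f p}"

definition zariski_closed :: "'i set \<Rightarrow> ('i \<Rightarrow> complex) set set \<Rightarrow> bool" where
  "zariski_closed I Z \<longleftrightarrow> (\<exists>A. A \<subseteq> (\<Union>n. forms I n) \<and> Z = zero_locus I A)"

definition zariski_closure :: "'i set \<Rightarrow> ('i \<Rightarrow> complex) set set \<Rightarrow> ('i \<Rightarrow> complex) set set" where
  "zariski_closure I S = zariski_closed I hull S"

definition linear_subspace :: "'i set \<Rightarrow> ('i \<Rightarrow> complex) set set \<Rightarrow> bool" where
  "linear_subspace I W \<longleftrightarrow> (\<exists>A. A \<subseteq> forms I 1 \<and> W = zero_locus I A)"

definition proj_span :: "'i set \<Rightarrow> ('i \<Rightarrow> complex) set set \<Rightarrow> ('i \<Rightarrow> complex) set set" where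
  "proj_span I S = linear_subspace I hull S"


section \<open>Subschemes and their linear spans\<close>

text \<open>
  A closed subscheme is given by a homogeneous ideal \<open>J\<close>.  A linear subspace cut out by
  linear forms contains the subscheme iff these forms lie in the saturation of \<open>J\<close>.
  The saturation matters: the ideal of \<open>X\<close> plus a power of the ideal of \<open>p\<close>
  need not contain any linear form at all.
\<close>

definition vanishing_ideal :: "'i set \<Rightarrow> ('i \<Rightarrow> complex) set set \<Rightarrow> 'i mpoly set" where
  "vanishing_ideal I S = {f \<in> carrier (poly_ring I). \<forall>p\<in>S. vanishes f p}"

definition saturation :: "'i set \<Rightarrow> 'i mpoly set \<Rightarrow> 'i mpoly set" where
  "saturation I J = {f \<in> carrier (poly_ring I). \<exists>m. \<forall>g\<in>forms I m. g * f \<in> J}"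

definition scheme_span :: "'i set \<Rightarrow> 'i mpoly set \<Rightarrow> ('i \<Rightarrow> complex) set set" where
  "scheme_span I J = zero_locus I (saturation I J \<inter> forms I 1)"

text \<open>The ideal of the scheme-theoretic intersection of \<open>X\<close> with the fat point \<open>k p\<close>:\<close>

definition inf_nbhd_ideal ::
    "'i set \<Rightarrow> nat \<Rightarrow> ('i \<Rightarrow> complex) set set \<Rightarrow> ('i \<Rightarrow> complex) set \<Rightarrow> 'i mpoly set" where
  "inf_nbhd_ideal I k X p =
     vanishing_ideal I X <+>\<^bsub>poly_ring I\<^esub>
       (vanishing_ideal I {p} [^]\<^bsub>ideals_set (poly_ring I)\<^esub> k)"


section \<open>Osculating and secant varieties\<close>

definition osculating_space ::
    "'i set \<Rightarrow> nat \<Rightarrow> ('i \<Rightarrow> complex) set set \<Rightarrow> ('i \<Rightarrow> complex) set \<Rightarrow> ('i \<Rightarrow> complex) set set" where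
  "osculating_space I k X p = scheme_span I (inf_nbhd_ideal I (k + 1) X p)"

definition osculating_variety ::
    "'i set \<Rightarrow> nat \<Rightarrow> ('i \<Rightarrow> complex) set set \<Rightarrow> ('i \<Rightarrow> complex) set set" where
  "osculating_variety I k X = zariski_closure I (\<Union>p\<in>X. osculating_space I k X p)"

definition open_secant ::
    "'i set \<Rightarrow> nat \<Rightarrow> ('i \<Rightarrow> complex) set set \<Rightarrow> ('i \<Rightarrow> complex) set set" where
  "open_secant I k X = \<Union>{proj_span I P | P. P \<subseteq> X \<and> finite P \<and> card P = k}"

definition secant_variety ::
    "'i set \<Rightarrow> nat \<Rightarrow> ('i \<Rightarrow> complex) set set \<Rightarrow> ('i \<Rightarrow> complex) set set" where
  "secant_variety I k X = zariski_closure I (open_secant I k X)"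

definition border_rank ::
    "'i set \<Rightarrow> ('i \<Rightarrow> complex) set set \<Rightarrow> ('i \<Rightarrow> complex) set \<Rightarrow> nat" where
  "border_rank I X T = (LEAST k. k \<ge> 1 \<and> T \<in> secant_variety I k X)"


section \<open>The Veronese surface\<close>

text \<open>
  The projective plane has coordinates indexed by \<open>{..2}\<close>; the target of the Veronese
  embedding has its coordinates indexed by the monomials of degree \<open>d\<close> in them.
\<close>

abbreviation plane :: "(nat \<Rightarrow> complex) set set" where
  "plane \<equiv> proj_space {..2}"

abbreviation veronese_coords :: "nat \<Rightarrow> (nat \<Rightarrow>\<^sub>0 nat) set" where
  "veronese_coords d \<equiv> monomials {..2} d"

definition veronese_vec :: "nat \<Rightarrow> (nat \<Rightarrow> complex) \<Rightarrow> (nat \<Rightarrow>\<^sub>0 nat) \<Rightarrow> complex" where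
  "veronese_vec d v \<alpha> = (if \<alpha> \<in> veronese_coords d then meval \<alpha> v else 0)"

definition veronese :: "nat \<Rightarrow> (nat \<Rightarrow> complex) set \<Rightarrow> ((nat \<Rightarrow>\<^sub>0 nat) \<Rightarrow> complex) set" where
  "veronese d p = (\<Union>v\<in>p. point (veronese_vec d v))"

definition veronese_surface :: "nat \<Rightarrow> ((nat \<Rightarrow>\<^sub>0 nat) \<Rightarrow> complex) set set" where
  "veronese_surface d = veronese d ` plane"

lemma mdeg_superset:
  assumes "finite I" "Poly_Mapping.keys \<alpha> \<subseteq> I"
  shows "mdeg \<alpha> = (\<Sum>i\<in>I. Poly_Mapping.lookup \<alpha> i)"
  unfolding mdeg_def using assms by (intro sum.mono_neutral_left) (auto simp: in_keys_iff)

lemma meval_superset: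
  assumes "finite I" "Poly_Mapping.keys \<alpha> \<subseteq> I"
  shows "meval \<alpha> v = (\<Prod>i\<in>I. v i ^ Poly_Mapping.lookup \<alpha> i)"
  unfolding meval_def using assms by (intro prod.mono_neutral_left) (auto simp: in_keys_iff)

lemma veronese_point:
  "veronese d (point v) = point (veronese_vec d v)"
proof -
  have 1: "veronese_vec d (\<lambda>i. c * v i) = (\<lambda>\<alpha>. c ^ d * veronese_vec d v \<alpha>)" for c
    by (auto simp: veronese_vec_def monomials_def meval_def mdeg_def fun_eq_iff
        power_mult_distrib prod.distrib power_sum)
  have 2: "point (\<lambda>\<alpha>. c * w \<alpha>) = point w" if "c \<noteq> 0" for c and w :: "'b \<Rightarrow> complex"
  proof -
    have "\<exists>c'. (\<lambda>i. e * w i) = (\<lambda>i. c' * (c * w i)) \<and> c' \<noteq> 0" if "e \<noteq> 0" for e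
      using that \<open>c \<noteq> 0\<close> by (intro exI[of _ "e / c"]) auto
    moreover have "\<exists>c'. (\<lambda>i. e * (c * w i)) = (\<lambda>i. c' * w i) \<and> c' \<noteq> 0" if "e \<noteq> 0" for e
      using that \<open>c \<noteq> 0\<close> by (intro exI[of _ "e * c"]) auto
    ultimately show ?thesis
      unfolding point_def by blast
  qed
  have "point (veronese_vec d w) = point (veronese_vec d v)" if "w \<in> point v" for w
    using that 2[of "_ ^ d" "veronese_vec d v"] by (auto simp: point_def[of v] 1)
  moreover have "v \<in> point v"
    unfolding point_def by (intro CollectI exI[of _ 1]) auto
  ultimately show ?thesis
    unfolding veronese_def by blast
qed

lemma veronese_surface_subset: "veronese_surface d \<subseteq> proj_space (veronese_coords d)"
proof -
  have "\<exists>\<alpha>. veronese_vec d v \<alpha> \<noteq> 0" if "v i \<noteq> 0" "\<forall>i. i \<notin> {..2} \<longrightarrow> v i = 0" for v i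
  proof -
    let ?a = "Poly_Mapping.single i d"
    have "i \<le> 2" using that by force
    then have "?a \<in> veronese_coords d"
      by (auto simp: monomials_def mdeg_def)
    moreover have "meval ?a v \<noteq> 0"
      using that by (auto simp: meval_def)
    ultimately show ?thesis
      by (auto simp: veronese_vec_def)
  qed
  then show ?thesis
    by (fastforce simp: veronese_surface_def proj_space_def veronese_point veronese_vec_def)
qed

text \<open>Hence the target is the projective space of dimension \<open>((d + 2) choose 2) - 1\<close>:\<close>

lemma card_veronese_coords:
  "finite (veronese_coords d)" "card (veronese_coords d) = (d + 2) choose 2"
proof -
  let ?S = "SIGMA a:{..d}. {..d - a}"
  let ?f = "\<lambda>\<alpha>. (Poly_Mapping.lookup \<alpha> (0::nat), Poly_Mapping.lookup \<alpha> 1)"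
  let ?g = "\<lambda>(a, b). Poly_Mapping.single 0 a + Poly_Mapping.single 1 b
              + Poly_Mapping.single (2::nat) (d - a - b)"
  have lk: "Poly_Mapping.lookup \<alpha> 2 = d - Poly_Mapping.lookup \<alpha> 0 - Poly_Mapping.lookup \<alpha> 1" "Poly_Mapping.lookup \<alpha> 0 + Poly_Mapping.lookup \<alpha> 1 \<le> d"
    if "\<alpha> \<in> veronese_coords d" for \<alpha>
    using that mdeg_superset[of "{..2}" \<alpha>] by (auto simp: monomials_def numeral_2_eq_2)
  have 1: "?g (?f \<alpha>) = \<alpha>" if "\<alpha> \<in> veronese_coords d" for \<alpha>
  proof (rule poly_mapping_eqI)
    fix i :: nat
    consider "i = 0" | "i = 1" | "i = 2" | "i > 2" by linarith
    then show "Poly_Mapping.lookup (?g (?f \<alpha>)) i = Poly_Mapping.lookup \<alpha> i"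
    proof cases
      case 4
      then have "i \<notin> Poly_Mapping.keys \<alpha>" using that by (auto simp: monomials_def)
      then show ?thesis using 4 by (simp add: lookup_add lookup_single in_keys_iff)
    qed (use lk[OF that] in \<open>simp_all add: lookup_add lookup_single\<close>)
  qed
  have 2: "?g x \<in> veronese_coords d \<and> ?f (?g x) = x" if "x \<in> ?S" for x
  proof -
    obtain a b where x: "x = (a, b)" "a \<le> d" "b \<le> d - a" using \<open>x \<in> ?S\<close> by auto
    have "Poly_Mapping.keys (?g x) \<subseteq> {..2}"
      by (auto simp: x in_keys_iff lookup_add lookup_single when_def split: if_splits)
    moreover from this have "mdeg (?g x) = d"
      using mdeg_superset[of "{..2}" "?g x"] x
      by (simp add: lookup_add lookup_single numeral_2_eq_2)
    ultimately show ?thesis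
      by (auto simp: monomials_def x lookup_add lookup_single)
  qed
  have bij: "bij_betw ?f (veronese_coords d) ?S"
  proof (rule bij_betw_byWitness[where f' = ?g])
    show "?f ` veronese_coords d \<subseteq> ?S"
    proof (clarify)
      fix \<alpha> assume "\<alpha> \<in> veronese_coords d"
      from lk(2)[OF this] show "Poly_Mapping.lookup \<alpha> 0 \<in> {..d} \<and> Poly_Mapping.lookup \<alpha> 1 \<in> {..d - Poly_Mapping.lookup \<alpha> 0}"
        by auto
    qed
  qed (use 1 2 in blast)+
  then show "finite (veronese_coords d)"
    by (simp add: bij_betw_finite)
  have "card (veronese_coords d) = (\<Sum>a\<le>d. d - a + 1)"
    using bij_betw_same_card[OF bij] by simp
  also have "\<dots> = (\<Sum>a\<le>d. Suc a)"
    using sum.atLeastAtMost_rev[of "\<lambda>a. Suc a" 0 d] by (simp add: atMost_atLeast0)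
  also have "\<dots> = (d + 2) choose 2"
    by (induction d) (auto simp: choose_two numeral_2_eq_2)
  finally show "card (veronese_coords d) = (d + 2) choose 2" .
qed

end

theory Submission
  imports Defs
begin

text \<open>
  A linear form that restricts to a form of degree \<open>d\<close> vanishing to order 3 at \<open>x\<close> lies in the
  saturation of the ideal of the second infinitesimal neighbourhood of \<open>\<nu>\<^sub>d(x)\<close>.  So every point
  \<open>T\<close> of the second osculating space pairs with a form \<open>f\<close> of degree \<open>d\<close> through its Taylor
  expansion at \<open>x\<close>: \<open>T(f) = a f(x) + \<partial>\<^sub>l f(x) + q(\<partial>) f(x)\<close>.  Over the complex
  numbers the binary quadratic form \<open>q\<close> is a product \<open>y z\<close>, and \<open>T\<close> is the limit for \<open>e \<rightarrow> 0\<close> of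
  \<open>(f(x + e y + e z + e\<^sup>2 l) - f(x + e y) - f(x + e z) + f(x)) / e\<^sup>2 + a f(x)\<close>,
  which involves only four points of the surface.  Equations of the secant variety hold along this
  curve, hence at \<open>T\<close> by continuity.
\<close>

section \<open>Evaluation of polynomials\<close>

lemma meval_add: "meval (\<alpha> + \<beta>) v = meval \<alpha> v * meval \<beta> v"
proof -
  let ?S = "Poly_Mapping.keys \<alpha> \<union> Poly_Mapping.keys \<beta>"
  have "Poly_Mapping.keys (\<alpha> + \<beta>) \<subseteq> ?S"
    by (rule keys_add)
  then show ?thesis
    using meval_superset[of ?S "\<alpha> + \<beta>" v] meval_superset[of ?S \<alpha> v] meval_superset[of ?S \<beta> v]
    by (simp add: lookup_add power_add prod.distrib)
qed

lemma meval_single: "meval (Poly_Mapping.single i n) v = v i ^ n"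
  by (simp add: meval_def)

lemma peval_superset:
  assumes "finite S" "Poly_Mapping.keys f \<subseteq> S"
  shows "peval f v = (\<Sum>\<alpha>\<in>S. Poly_Mapping.lookup f \<alpha> * meval \<alpha> v)"
  unfolding peval_def using assms by (intro sum.mono_neutral_left) (auto simp: in_keys_iff)

lemma peval_add: "peval (f + g) v = peval f v + peval g v"
proof -
  let ?S = "Poly_Mapping.keys f \<union> Poly_Mapping.keys g"
  have "Poly_Mapping.keys (f + g) \<subseteq> ?S"
    by (rule keys_add)
  then show ?thesis
    using peval_superset[of ?S "f + g" v] peval_superset[of ?S f v] peval_superset[of ?S g v]
    by (simp add: lookup_add algebra_simps sum.distrib)
qed

lemma peval_uminus: "peval (- f) v = - peval f v"
  by (simp add: peval_def sum_negf)

lemma peval_0: "peval 0 v = 0"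
  by (simp add: peval_def)

lemma peval_sum: "peval (sum f A) v = (\<Sum>a\<in>A. peval (f a) v)"
  by (induction A rule: infinite_finite_induct) (simp_all add: peval_0 peval_add)

lemma peval_single: "peval (Poly_Mapping.single \<alpha> c) v = c * meval \<alpha> v"
  by (simp add: peval_def)

lemma sum_single_eq:
  "(\<Sum>\<alpha>\<in>Poly_Mapping.keys f. Poly_Mapping.single \<alpha> (Poly_Mapping.lookup f \<alpha>)) = f"
  by (rule poly_mapping_eqI)
    (auto simp: lookup_sum lookup_single when_def in_keys_iff)

lemma peval_mult: "peval (f * g) v = peval f v * peval g v"
proof -
  have "f * g =
      (\<Sum>\<alpha>\<in>Poly_Mapping.keys f. \<Sum>\<beta>\<in>Poly_Mapping.keys g.
         Poly_Mapping.single (\<alpha> + \<beta>) (Poly_Mapping.lookup f \<alpha> * Poly_Mapping.lookup g \<beta>))"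
    unfolding mult_single[symmetric] sum_product[symmetric] sum_single_eq ..
  then show ?thesis
    by (simp add: peval_sum peval_single meval_add)
      (simp add: peval_def sum_product algebra_simps)
qed

lemma tendsto_peval:
  assumes "\<And>i. ((\<lambda>e. t e i) \<longlongrightarrow> u i) F"
  shows "((\<lambda>e. peval f (t e)) \<longlongrightarrow> peval f u) F"
  unfolding peval_def meval_def
  by (intro tendsto_intros assms)

lemma poly_ring_closed:
  assumes "f \<in> carrier (poly_ring I)" "g \<in> carrier (poly_ring I)"
  shows "f + g \<in> carrier (poly_ring I)" "f * g \<in> carrier (poly_ring I)"
    "f - g \<in> carrier (poly_ring I)"
proof -
  interpret cring "poly_ring I"
    by (rule cring_poly_ring)
  have ops: "p \<oplus>\<^bsub>poly_ring I\<^esub> q = p + q" "p \<otimes>\<^bsub>poly_ring I\<^esub> q = p * q" for p q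
    by (simp_all add: poly_ring_def)
  have g: "- g \<in> carrier (poly_ring I)"
    using assms(2) by (simp add: poly_ring_def)
  show "f + g \<in> carrier (poly_ring I)" "f * g \<in> carrier (poly_ring I)"
    using a_closed[OF assms] m_closed[OF assms] by (simp_all only: ops)
  show "f - g \<in> carrier (poly_ring I)"
    using a_closed[OF assms(1) g] by (simp only: ops diff_conv_add_uminus)
qed

section \<open>Linear forms on the ambient space\<close>

definition linform :: "'i set \<Rightarrow> ('i \<Rightarrow> complex) \<Rightarrow> 'i mpoly" where
  "linform I c = (\<Sum>i\<in>I. Poly_Mapping.single (Poly_Mapping.single i 1) (c i))"

lemma peval_linform: "peval (linform I c) v = (\<Sum>i\<in>I. c i * v i)"
  by (simp add: linform_def peval_sum peval_single meval_single)

lemma linform_in_forms: "linform I c \<in> forms I 1"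
proof -
  have "Poly_Mapping.keys (linform I c) \<subseteq>
      (\<Union>i\<in>I. Poly_Mapping.keys (Poly_Mapping.single (Poly_Mapping.single i (1::nat)) (c i)))"
    unfolding linform_def by (rule keys_sum)
  also have "\<dots> \<subseteq> monomials I 1"
    by (auto simp: monomials_def mdeg_def split: if_splits)
  finally show ?thesis
    by (simp add: forms_def)
qed

lemma mdeg_eq_1:
  assumes "mdeg \<alpha> = 1"
  shows "\<exists>i. \<alpha> = Poly_Mapping.single i 1"
proof -
  obtain i where i: "i \<in> Poly_Mapping.keys \<alpha>"
    using assms by (fastforce simp: mdeg_def)
  have s: "Poly_Mapping.lookup \<alpha> i + (\<Sum>j\<in>Poly_Mapping.keys \<alpha> - {i}. Poly_Mapping.lookup \<alpha> j) = 1"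
    using assms i by (simp add: mdeg_def flip: sum.remove)
  have "Poly_Mapping.lookup \<alpha> i \<noteq> 0"
    using i by (simp add: in_keys_iff)
  then have 1: "Poly_Mapping.lookup \<alpha> i = 1"
    and "(\<Sum>j\<in>Poly_Mapping.keys \<alpha> - {i}. Poly_Mapping.lookup \<alpha> j) = 0"
    using s by linarith+
  then have "Poly_Mapping.lookup \<alpha> j = 0" if "j \<noteq> i" for j
    using that by (auto simp: in_keys_iff)
  then have "\<alpha> = Poly_Mapping.single i 1"
    by (intro poly_mapping_eqI) (auto simp: lookup_single when_def 1)
  then show ?thesis ..
qed

text \<open>Every monomial of degree 1 is a single coordinate. This carries the equations of a
  linear subspace over to combinations of its points.\<close>

lemma peval_forms_1_linear:
  assumes "f \<in> forms I 1"
  shows "peval f (\<lambda>i. \<Sum>n\<in>N. c n * t n i) = (\<Sum>n\<in>N. c n * peval f (t n))"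
proof -
  have "meval \<alpha> (\<lambda>i. \<Sum>n\<in>N. c n * t n i) = (\<Sum>n\<in>N. c n * meval \<alpha> (t n))"
    if "\<alpha> \<in> Poly_Mapping.keys f" for \<alpha>
  proof -
    have "mdeg \<alpha> = 1"
      using that assms by (auto simp: forms_def monomials_def)
    then show ?thesis
      using mdeg_eq_1[of \<alpha>] by (auto simp: meval_single)
  qed
  then have "peval f (\<lambda>i. \<Sum>n\<in>N. c n * t n i) =
      (\<Sum>\<alpha>\<in>Poly_Mapping.keys f. \<Sum>n\<in>N. c n * (Poly_Mapping.lookup f \<alpha> * meval \<alpha> (t n)))"
    by (simp add: peval_def sum_distrib_left algebra_simps)
  also have "\<dots> = (\<Sum>n\<in>N. c n * peval f (t n))"
    by (subst sum.swap) (simp add: peval_def sum_distrib_left)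
  finally show ?thesis .
qed

section \<open>Homogeneous functions in three variables\<close>

text \<open>Forms are treated as functions, so identities are checked pointwise and uniqueness of
  coefficients never arises. Building them one variable at a time gives the induction behind
  splitting and division below.\<close>

inductive form_fun :: "nat \<Rightarrow> ((nat \<Rightarrow> complex) \<Rightarrow> complex) \<Rightarrow> bool" where
  const: "form_fun 0 (\<lambda>_. c)"
| var: "i \<le> 2 \<Longrightarrow> form_fun n f \<Longrightarrow> form_fun (Suc n) (\<lambda>v. v i * f v)"
| add: "form_fun n f \<Longrightarrow> form_fun n g \<Longrightarrow> form_fun n (\<lambda>v. f v + g v)"

lemma form_fun_scale: "form_fun n f \<Longrightarrow> form_fun n (\<lambda>v. c * f v)"
proof (induction rule: form_fun.induct)
  case (const b)
  show ?case by (rule form_fun.const)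
next
  case (var i n f)
  then show ?case
    using form_fun.var[of i n "\<lambda>v. c * f v"] by (simp add: mult.left_commute)
next
  case (add n f g)
  then show ?case
    using form_fun.add[of n "\<lambda>v. c * f v" "\<lambda>v. c * g v"] by (simp add: distrib_left)
qed

lemma form_fun_power: "i \<le> 2 \<Longrightarrow> form_fun n f \<Longrightarrow> form_fun (m + n) (\<lambda>v. v i ^ m * f v)"
proof (induction m)
  case (Suc m)
  then show ?case
    using form_fun.var[of i "m + n" "\<lambda>v. v i ^ m * f v"] by (simp add: mult.assoc)
qed simp

lemma form_fun_var_power: "i \<le> 2 \<Longrightarrow> form_fun m (\<lambda>v. v i ^ m)"
  using form_fun_power[OF _ form_fun.const[of 1]] by simp

lemma form_fun_zero: "form_fun n (\<lambda>_. 0)"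
  using form_fun_scale[OF form_fun_var_power[of 0 n], of 0] by simp

lemma form_fun_mult:
  "form_fun n f \<Longrightarrow> form_fun m g \<Longrightarrow> form_fun (n + m) (\<lambda>v. f v * g v)"
proof (induction rule: form_fun.induct)
  case (const b)
  then show ?case by (simp add: form_fun_scale)
next
  case (var i n f)
  then show ?case
    using form_fun.var[of i "n + m" "\<lambda>v. f v * g v"] by (simp add: mult.assoc)
next
  case (add n f f')
  then show ?case
    using form_fun.add[of "n + m" "\<lambda>v. f v * g v" "\<lambda>v. f' v * g v"] by (simp add: distrib_right)
qed

lemma form_fun_sum:
  "(\<And>a. a \<in> A \<Longrightarrow> form_fun n (f a)) \<Longrightarrow> form_fun n (\<lambda>v. \<Sum>a\<in>A. f a v)"
  by (induction A rule: infinite_finite_induct) (auto intro: form_fun_zero form_fun.add)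

lemma form_fun_pow: "form_fun n f \<Longrightarrow> form_fun (m * n) (\<lambda>v. f v ^ m)"
proof (induction m)
  case 0
  show ?case using form_fun.const[of 1] by simp
next
  case (Suc m)
  then show ?case
    using form_fun_mult[of n f "m * n"] by simp
qed

lemma form_fun_prod:
  "(\<And>a. a \<in> A \<Longrightarrow> form_fun (n a) (f a)) \<Longrightarrow> form_fun (\<Sum>a\<in>A. n a) (\<lambda>v. \<Prod>a\<in>A. f a v)"
proof (induction A rule: infinite_finite_induct)
  case (insert a A)
  then show ?case
    using form_fun_mult[of "n a" "f a"] by simp
qed (simp_all add: form_fun.const)

lemma form_fun_meval:
  assumes "\<alpha> \<in> veronese_coords n"
  shows "form_fun n (meval \<alpha>)"
proof -
  have k: "Poly_Mapping.keys \<alpha> \<subseteq> {..2}" and "mdeg \<alpha> = n"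
    using assms by (auto simp: monomials_def)
  then have n: "n = (\<Sum>i\<le>2. Poly_Mapping.lookup \<alpha> i)"
    using mdeg_superset[of "{..2}" \<alpha>] by simp
  have "meval \<alpha> = (\<lambda>v. \<Prod>i\<le>2. v i ^ Poly_Mapping.lookup \<alpha> i)"
    using meval_superset[OF _ k] by auto
  then show ?thesis
    unfolding n by (auto intro!: form_fun_prod form_fun_var_power)
qed

lemma form_fun_coeffs:
  "form_fun n f \<Longrightarrow> \<exists>c. \<forall>v. f v = (\<Sum>\<alpha>\<in>veronese_coords n. c \<alpha> * meval \<alpha> v)"
proof (induction rule: form_fun.induct)
  case (const b)
  have "Poly_Mapping.keys \<alpha> = {}" if "\<alpha> \<in> veronese_coords 0" for \<alpha>
    using that by (fastforce simp: monomials_def mdeg_def)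
  then have "veronese_coords 0 = {0}"
    by (auto simp: monomials_def mdeg_def keys_eq_empty)
  then show ?case
    by (intro exI[of _ "\<lambda>_. b"]) (simp add: meval_def)
next
  case (var i n f)
  then obtain c where c: "\<And>v. f v = (\<Sum>\<alpha>\<in>veronese_coords n. c \<alpha> * meval \<alpha> v)"
    by blast
  let ?e = "Poly_Mapping.single i (1::nat)"
  \<comment> \<open>Multiplication by the variable shifts exponent vectors injectively; vectors
    outside the image get coefficient 0.\<close>
  let ?J = "(\<lambda>\<alpha>. \<alpha> + ?e) ` veronese_coords n"
  have J: "?J \<subseteq> veronese_coords (Suc n)"
  proof clarify
    fix \<alpha> assume a: "\<alpha> \<in> veronese_coords n"
    have k: "Poly_Mapping.keys (\<alpha> + ?e) \<subseteq> {..2}"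
      using keys_add[of \<alpha> ?e] a \<open>i \<le> 2\<close> by (fastforce simp: monomials_def)
    have "(\<Sum>j\<le>2. Poly_Mapping.lookup ?e j) = 1"
      using \<open>i \<le> 2\<close> by (simp add: lookup_single when_def)
    then show "\<alpha> + ?e \<in> veronese_coords (Suc n)"
      using k a mdeg_superset[of "{..2}" "\<alpha> + ?e"] mdeg_superset[of "{..2}" \<alpha>]
      by (simp add: monomials_def lookup_add sum.distrib)
  qed
  have "v i * f v =
      (\<Sum>\<beta>\<in>veronese_coords (Suc n). (if \<beta> \<in> ?J then c (\<beta> - ?e) else 0) * meval \<beta> v)" for v
  proof -
    have "(\<Sum>\<beta>\<in>veronese_coords (Suc n). (if \<beta> \<in> ?J then c (\<beta> - ?e) else 0) * meval \<beta> v)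
        = (\<Sum>\<beta>\<in>?J. c (\<beta> - ?e) * meval \<beta> v)"
      by (rule sum.mono_neutral_cong_right) (use J card_veronese_coords(1) in auto)
    also have "\<dots> = (\<Sum>\<alpha>\<in>veronese_coords n. c \<alpha> * meval (\<alpha> + ?e) v)"
      by (subst sum.reindex) (auto simp: inj_on_def)
    also have "\<dots> = v i * f v"
      by (simp add: c meval_add meval_single sum_distrib_left algebra_simps)
    finally show ?thesis by simp
  qed
  then show ?case
    by (intro exI[of _ "\<lambda>\<beta>. if \<beta> \<in> ?J then c (\<beta> - ?e) else 0"]) blast
next
  case (add n f g)
  then obtain c c' where "\<And>v. f v = (\<Sum>\<alpha>\<in>veronese_coords n. c \<alpha> * meval \<alpha> v)"
    "\<And>v. g v = (\<Sum>\<alpha>\<in>veronese_coords n. c' \<alpha> * meval \<alpha> v)"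
    by blast
  then show ?case
    by (intro exI[of _ "\<lambda>\<alpha>. c \<alpha> + c' \<alpha>"]) (simp add: distrib_right sum.distrib)
qed

text \<open>The coordinates of the Veronese vector are all the monomials of degree \<open>d\<close>,
  so linear forms on the ambient space restrict to every form of degree \<open>d\<close>.\<close>

lemma form_fun_linform:
  assumes "form_fun d f"
  obtains c where "\<And>v. peval (linform (veronese_coords d) c) (veronese_vec d v) = f v"
proof -
  obtain c where "\<And>v. f v = (\<Sum>\<alpha>\<in>veronese_coords d. c \<alpha> * meval \<alpha> v)"
    using form_fun_coeffs[OF assms] by blast
  then show ?thesis
    by (intro that[of c]) (simp add: peval_linform veronese_vec_def)
qed

lemma form_fun_0D: "form_fun 0 f \<Longrightarrow> \<exists>c. f = (\<lambda>_. c)"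
  by (induction "0::nat" f rule: form_fun.induct) auto

section \<open>Splitting forms into products of prescribed degrees\<close>

inductive prod_span :: "nat \<Rightarrow> nat \<Rightarrow> ((nat \<Rightarrow> complex) \<Rightarrow> complex) \<Rightarrow> bool" for a b where
  prod: "form_fun a g \<Longrightarrow> form_fun b h \<Longrightarrow> prod_span a b (\<lambda>v. g v * h v)"
| add: "prod_span a b f \<Longrightarrow> prod_span a b g \<Longrightarrow> prod_span a b (\<lambda>v. f v + g v)"

lemma prod_span_var:
  "prod_span a b f \<Longrightarrow> i \<le> 2 \<Longrightarrow> prod_span (Suc a) b (\<lambda>v. v i * f v)"
proof (induction rule: prod_span.induct)
  case (prod g h)
  then show ?case
    using prod_span.prod[OF form_fun.var, of i a g b h] by (simp add: mult.assoc)
next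
  case (add f g)
  then show ?case
    using prod_span.add[of "Suc a" b "\<lambda>v. v i * f v" "\<lambda>v. v i * g v"] by (simp add: distrib_left)
qed

text \<open>A form need not factor, but each monomial does: \<open>a\<close> variables are peeled
  off one by one and collected in the left factor.\<close>

lemma form_fun_split: "form_fun (a + b) f \<Longrightarrow> prod_span a b f"
proof (induction a arbitrary: f)
  case 0
  then show ?case
    using prod_span.prod[OF form_fun.const[of 1], of b f] by simp
next
  case (Suc a)
  have "prod_span (Suc a) b f" if "form_fun n f" "n = Suc (a + b)" for n f
    using that
  proof (induction rule: form_fun.induct)
    case (var i n f)
    then show ?case by (intro prod_span_var Suc.IH) auto
  qed (auto intro: prod_span.add)
  then show ?case
    using Suc.prems by simp
qed

text \<open>Each coordinate substituted into \<open>G\<close> has degree \<open>d\<close>, so a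
  monomial of degree \<open>n\<close> turns into a form of degree \<open>n * d\<close>.\<close>

lemma form_fun_peval_veronese:
  assumes "G \<in> forms (veronese_coords d) n"
  shows "form_fun (n * d) (\<lambda>v. peval G (veronese_vec d v))"
proof -
  have "form_fun (n * d) (\<lambda>v. meval A (veronese_vec d v))" if "A \<in> Poly_Mapping.keys G" for A
  proof -
    have "A \<in> monomials (veronese_coords d) n"
      using that assms by (auto simp: forms_def)
    then have A: "Poly_Mapping.keys A \<subseteq> veronese_coords d" "mdeg A = n"
      by (simp_all add: monomials_def[of "veronese_coords d"])
    have "form_fun (\<Sum>\<alpha>\<in>Poly_Mapping.keys A. Poly_Mapping.lookup A \<alpha> * d)
        (\<lambda>v. \<Prod>\<alpha>\<in>Poly_Mapping.keys A. meval \<alpha> v ^ Poly_Mapping.lookup A \<alpha>)"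
      by (intro form_fun_prod form_fun_pow form_fun_meval) (rule subsetD[OF A(1)], assumption)
    moreover have "(\<Sum>\<alpha>\<in>Poly_Mapping.keys A. Poly_Mapping.lookup A \<alpha> * d) = n * d"
      using A(2) by (simp add: mdeg_def flip: sum_distrib_right)
    moreover have "meval A (veronese_vec d v) =
        (\<Prod>\<alpha>\<in>Poly_Mapping.keys A. meval \<alpha> v ^ Poly_Mapping.lookup A \<alpha>)" for v
      unfolding meval_def[of A] using A(1) by (intro prod.cong) (auto simp: veronese_vec_def)
    ultimately show ?thesis by simp
  qed
  then show ?thesis
    unfolding peval_def by (intro form_fun_sum form_fun_scale)
qed

lemma tendsto_form_fun:
  assumes "form_fun n f" "\<And>i. ((\<lambda>e. t e i) \<longlongrightarrow> u i) F"
  shows "((\<lambda>e. f (t e)) \<longlongrightarrow> f u) F"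
  using assms(1)
proof (induction rule: form_fun.induct)
  case (const c)
  show ?case by (rule tendsto_const)
next
  case (var i n f)
  show ?case by (rule tendsto_mult[OF assms(2) var.IH])
next
  case (add n f g)
  show ?case by (rule tendsto_add[OF add.IH])
qed

section \<open>Taylor expansion at a point of the plane\<close>

text \<open>
  The point is normalised so that its coordinate \<open>j\<close> is 1.  Then \<open>v j\<close>, \<open>w k\<close> and \<open>w m\<close>
  are linear coordinates on the affine cone over the plane, and the last two vanish at the point.
\<close>

locale chart =
  fixes x :: "nat \<Rightarrow> complex" and j k m :: nat
  assumes x_j: "x j = 1" and x_outside: "i \<notin> {..2} \<Longrightarrow> x i = 0"
    and indices: "{..2} = {j, k, m}" "j \<noteq> k" "j \<noteq> m" "k \<noteq> m"
begin

definition w :: "nat \<Rightarrow> (nat \<Rightarrow> complex) \<Rightarrow> complex" where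
  "w i v = v i - x i * v j"

lemma index_le: "j \<le> 2" "k \<le> 2" "m \<le> 2"
  using indices(1) by auto

lemma form_fun_w_mult:
  assumes "i \<in> {k, m}" "form_fun n f"
  shows "form_fun (Suc n) (\<lambda>v. w i v * f v)"
proof -
  have "i \<le> 2"
    using assms(1) index_le by auto
  then have "form_fun (Suc n) (\<lambda>v. v i * f v + (- x i) * (v j * f v))"
    using assms(2) index_le(1) by (intro form_fun.add form_fun_scale form_fun.var)
  then show ?thesis
    by (simp add: w_def algebra_simps)
qed

text \<open>The degree \<open>d\<close> part of the cube of the ideal generated by
  \<open>w k\<close> and \<open>w m\<close>, that is, the forms vanishing to order 3 at the point.
  The clause \<open>zero\<close> supplies the remainder when \<open>d\<close> is below 3.\<close>

inductive cubic :: "nat \<Rightarrow> ((nat \<Rightarrow> complex) \<Rightarrow> complex) \<Rightarrow> bool" where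
  zero: "cubic d (\<lambda>_. 0)"
| mult: "i1 \<in> {k, m} \<Longrightarrow> i2 \<in> {k, m} \<Longrightarrow> i3 \<in> {k, m} \<Longrightarrow> form_fun n h
    \<Longrightarrow> cubic (Suc (Suc (Suc n))) (\<lambda>v. w i1 v * (w i2 v * (w i3 v * h v)))"
| add: "cubic d f \<Longrightarrow> cubic d g \<Longrightarrow> cubic d (\<lambda>v. f v + g v)"

text \<open>Substituting \<open>v i = x i * v j + w i v\<close> for one variable at a time reduces a
  form modulo \<open>w k\<close> and \<open>w m\<close> to a multiple of a power of
  \<open>v j\<close>.\<close>

lemma form_fun_divide:
  "form_fun (Suc n) f \<Longrightarrow>
    \<exists>c g1 g2. form_fun n g1 \<and> form_fun n g2 \<and>
      f = (\<lambda>v. c * v j ^ Suc n + w k v * g1 v + w m v * g2 v)"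
proof (induction "Suc n" f arbitrary: n rule: form_fun.induct)
  case (var i n f)
  have v_i: "v i = x i * v j + w i v" for v
    by (simp add: w_def)
  \<comment> \<open>Quotients of \<open>f\<close> would have degree \<open>n - 1\<close>, which
    makes no sense for \<open>n = 0\<close>; hence only their products with \<open>v j\<close> are
    given a degree.\<close>
  obtain c g1 g2 where g: "form_fun n (\<lambda>v. v j * g1 v)" "form_fun n (\<lambda>v. v j * g2 v)"
    and f: "f = (\<lambda>v. c * v j ^ n + w k v * g1 v + w m v * g2 v)"
  proof (cases n)
    case 0
    then obtain c where "f = (\<lambda>_. c)"
      using form_fun_0D var.hyps(2) by blast
    then show ?thesis
      using that[of "\<lambda>_. 0" "\<lambda>_. 0" c] by (simp add: 0 form_fun_zero)
  next
    case (Suc n')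
    from var.hyps(3)[OF Suc] obtain c g1 g2 where "form_fun n' g1" "form_fun n' g2"
      "f = (\<lambda>v. c * v j ^ n + w k v * g1 v + w m v * g2 v)"
      unfolding Suc by blast
    then show ?thesis
      using that[of g1 g2 c] form_fun.var[OF index_le(1)] by (simp add: Suc)
  qed
  \<comment> \<open>The term \<open>w i v * f v\<close> stays whole: it is zero for
    \<open>i = j\<close>, and otherwise joins the quotient that belongs to
    \<open>w i\<close>.\<close>
  have f': "v i * f v = x i * c * v j ^ Suc n + w k v * (x i * (v j * g1 v))
      + w m v * (x i * (v j * g2 v)) + w i v * f v" for v
    by (subst v_i[of v]) (simp add: f algebra_simps)
  consider "i = j" | "i = k" | "i = m"
    using var.hyps(1) indices(1) by auto
  then show ?case
  proof cases
    case 1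
    then have "w i v = 0" for v
      by (simp add: w_def x_j)
    then show ?thesis
      by (intro exI[of _ "x i * c"] exI[of _ "\<lambda>v. x i * (v j * g1 v)"]
          exI[of _ "\<lambda>v. x i * (v j * g2 v)"])
        (simp add: f' form_fun_scale g)
  next
    case 2
    then have "v i * f v = x i * c * v j ^ Suc n + w k v * (x i * (v j * g1 v) + f v)
      + w m v * (x i * (v j * g2 v))" for v
      using f'[of v] by (simp add: algebra_simps)
    then show ?thesis
      by (intro exI[of _ "x i * c"] exI[of _ "\<lambda>v. x i * (v j * g1 v) + f v"]
          exI[of _ "\<lambda>v. x i * (v j * g2 v)"] conjI ext form_fun.add form_fun_scale g var.hyps(2))
  next
    case 3
    then have "v i * f v = x i * c * v j ^ Suc n + w k v * (x i * (v j * g1 v))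
      + w m v * (x i * (v j * g2 v) + f v)" for v
      using f'[of v] by (simp add: algebra_simps)
    then show ?thesis
      by (intro exI[of _ "x i * c"] exI[of _ "\<lambda>v. x i * (v j * g1 v)"]
          exI[of _ "\<lambda>v. x i * (v j * g2 v) + f v"] conjI ext form_fun.add form_fun_scale g var.hyps(2))
  qed
next
  case (add f g)
  obtain c g1 g2 where f: "form_fun n g1" "form_fun n g2"
      "f = (\<lambda>v. c * v j ^ Suc n + w k v * g1 v + w m v * g2 v)"
    using add.hyps(2) by blast
  obtain c' g1' g2' where g: "form_fun n g1'" "form_fun n g2'"
      "g = (\<lambda>v. c' * v j ^ Suc n + w k v * g1' v + w m v * g2' v)"
    using add.hyps(4) by blast
  show ?case
    by (intro exI[of _ "c + c'"] exI[of _ "\<lambda>v. g1 v + g1' v"] exI[of _ "\<lambda>v. g2 v + g2' v"]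
        conjI form_fun.add f g ext) (simp add: f(3) g(3) algebra_simps)
qed

text \<open>The last division may start in degree 0, where there are no quotients. Describing the
  remainder only after multiplication by two more linear factors covers that case too, with
  remainder 0.\<close>

lemma form_fun_divide_remainder:
  assumes "form_fun n f"
  shows "\<exists>c r. (\<forall>i1\<in>{k, m}. \<forall>i2\<in>{k, m}. cubic (Suc (Suc n)) (\<lambda>v. w i1 v * (w i2 v * r v)))
    \<and> f = (\<lambda>v. c * v j ^ n + r v)"
proof (cases n)
  case 0
  then obtain c where "f = (\<lambda>_. c)"
    using form_fun_0D assms by blast
  then show ?thesis
    by (intro exI[of _ c] exI[of _ "\<lambda>_. 0"]) (simp add: 0 cubic.zero)
next
  case (Suc n')
  obtain c g1 g2 where g: "form_fun n' g1" "form_fun n' g2"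
      and f: "f = (\<lambda>v. c * v j ^ Suc n' + w k v * g1 v + w m v * g2 v)"
    using form_fun_divide assms unfolding Suc by blast
  show ?thesis
  proof (intro exI[of _ c] exI[of _ "\<lambda>v. w k v * g1 v + w m v * g2 v"] conjI ballI)
    fix i1 i2 assume i: "i1 \<in> {k, m}" "i2 \<in> {k, m}"
    have "cubic (Suc (Suc n))
        (\<lambda>v. w i1 v * (w i2 v * (w k v * g1 v)) + w i1 v * (w i2 v * (w m v * g2 v)))"
      unfolding Suc by (intro cubic.add cubic.mult i g) auto
    then show "cubic (Suc (Suc n)) (\<lambda>v. w i1 v * (w i2 v * (w k v * g1 v + w m v * g2 v)))"
      by (simp add: distrib_left)
  qed (simp add: f Suc algebra_simps)
qed

text \<open>The second-order Taylor expansion in homogeneous form, with powers of \<open>v j\<close>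
  making up the degree. It is a relation, so the coefficients need no uniqueness proof.\<close>

definition expansion ::
    "nat \<Rightarrow> ((nat \<Rightarrow> complex) \<Rightarrow> complex) \<Rightarrow> complex \<Rightarrow> complex \<Rightarrow> complex \<Rightarrow> complex \<Rightarrow> complex \<Rightarrow> complex
      \<Rightarrow> ((nat \<Rightarrow> complex) \<Rightarrow> complex) \<Rightarrow> bool" where
  "expansion d f c c1 c2 c11 c12 c22 r \<longleftrightarrow> cubic d r \<and>
    (\<forall>v. f v = c * v j ^ d + c1 * (w k v * v j ^ (d - 1)) + c2 * (w m v * v j ^ (d - 1))
      + c11 * (w k v * (w k v * v j ^ (d - 2))) + c12 * (w k v * (w m v * v j ^ (d - 2)))
      + c22 * (w m v * (w m v * v j ^ (d - 2))) + r v)"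

lemma ex_expansion:
  assumes "form_fun d f" "d \<ge> 2"
  shows "\<exists>c c1 c2 c11 c12 c22 r. expansion d f c c1 c2 c11 c12 c22 r"
proof -
  obtain n where d: "d = Suc (Suc n)"
    using assms(2) by (metis add_2_eq_Suc le_Suc_ex)
  obtain c g1 g2 where g: "form_fun (Suc n) g1" "form_fun (Suc n) g2"
      and f: "f = (\<lambda>v. c * v j ^ d + w k v * g1 v + w m v * g2 v)"
    using form_fun_divide[of "Suc n" f] assms(1) d by auto
  obtain c1 h1 h2 where h: "form_fun n h1" "form_fun n h2"
      and g1: "g1 = (\<lambda>v. c1 * v j ^ Suc n + w k v * h1 v + w m v * h2 v)"
    using form_fun_divide[OF g(1)] by blast
  obtain c2 h3 h4 where h': "form_fun n h3" "form_fun n h4"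
      and g2: "g2 = (\<lambda>v. c2 * v j ^ Suc n + w k v * h3 v + w m v * h4 v)"
    using form_fun_divide[OF g(2)] by blast
  obtain b1 r1 where r1: "h1 = (\<lambda>v. b1 * v j ^ n + r1 v)"
      "cubic d (\<lambda>v. w k v * (w k v * r1 v))"
    using form_fun_divide_remainder[OF h(1)] unfolding d by blast
  obtain b2 r2 where r2: "h2 = (\<lambda>v. b2 * v j ^ n + r2 v)"
      "cubic d (\<lambda>v. w k v * (w m v * r2 v))"
    using form_fun_divide_remainder[OF h(2)] unfolding d by blast
  obtain b3 r3 where r3: "h3 = (\<lambda>v. b3 * v j ^ n + r3 v)"
      "cubic d (\<lambda>v. w m v * (w k v * r3 v))"
    using form_fun_divide_remainder[OF h'(1)] unfolding d by blast
  obtain b4 r4 where r4: "h4 = (\<lambda>v. b4 * v j ^ n + r4 v)"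
      "cubic d (\<lambda>v. w m v * (w m v * r4 v))"
    using form_fun_divide_remainder[OF h'(2)] unfolding d by blast
  \<comment> \<open>The mixed product of \<open>w k v\<close> and \<open>w m v\<close> arises from
    both first-order quotients, hence the coefficient \<open>b2 + b3\<close>.\<close>
  have "expansion d f c c1 c2 b1 (b2 + b3) b4
    (\<lambda>v. (w k v * (w k v * r1 v) + w k v * (w m v * r2 v))
       + (w m v * (w k v * r3 v) + w m v * (w m v * r4 v)))"
    unfolding expansion_def
    by (intro conjI cubic.add r1 r2 r3 r4 allI)
      (simp add: f g1 g2 r1 r2 r3 r4 d algebra_simps)
  then show ?thesis by blast
qed

section \<open>Curves through the centre in the affine chart\<close>

definition aff :: "complex \<Rightarrow> complex \<Rightarrow> nat \<Rightarrow> complex" where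
  "aff p q i = x i + (if i = k then p else if i = m then q else 0)"

lemma aff_j [simp]: "aff p q j = 1"
  using indices by (simp add: aff_def x_j)

lemma w_aff: "i \<in> {k, m} \<Longrightarrow> w i (aff p q) = (if i = k then p else q)"
  using indices by (auto simp: w_def aff_def x_j)

lemma tendsto_aff:
  assumes "(p \<longlongrightarrow> p0) F" "(q \<longlongrightarrow> q0) F"
  shows "((\<lambda>e. aff (p e) (q e) i) \<longlongrightarrow> aff p0 q0 i) F"
  using assms by (auto simp: aff_def intro!: tendsto_intros)

text \<open>Each of the three linear factors contributes an \<open>e\<close>. After division by
  \<open>e^2\<close> one \<open>e\<close> remains, times a quantity with a finite limit.\<close>

lemma tendsto_cubic:
  assumes "cubic d r" "(p \<longlongrightarrow> p0) (at 0)" "(q \<longlongrightarrow> q0) (at 0)"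
  shows "((\<lambda>e. r (aff (e * p e) (e * q e)) / e^2) \<longlongrightarrow> 0) (at 0)"
  using assms(1)
proof (induction rule: cubic.induct)
  case (mult i1 i2 i3 n h)
  define W where "W i = (if i = k then p else q)" for i
  define W0 where "W0 i = (if i = k then p0 else q0)" for i
  have W: "(W i \<longlongrightarrow> W0 i) (at 0)" for i
    using assms(2,3) by (simp add: W_def W0_def)
  have wW: "w i (aff (e * p e) (e * q e)) = e * W i e" if "i \<in> {k, m}" for i e
    using w_aff[OF that] by (simp add: W_def)
  have "((\<lambda>e. e * (W i1 e * W i2 e * W i3 e * h (aff (e * p e) (e * q e)))) \<longlongrightarrow>
      0 * (W0 i1 * W0 i2 * W0 i3 * h (aff (0 * p0) (0 * q0)))) (at 0)"
    by (intro tendsto_mult W tendsto_form_fun[OF mult.hyps(4)] tendsto_aff tendsto_ident_at assms(2,3))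
  \<comment> \<open>This also holds at \<open>e = 0\<close>, where division by zero yields
    0.\<close>
  moreover have "e * (W i1 e * W i2 e * W i3 e * h (aff (e * p e) (e * q e))) =
      w i1 (aff (e * p e) (e * q e)) * (w i2 (aff (e * p e) (e * q e)) *
        (w i3 (aff (e * p e) (e * q e)) * h (aff (e * p e) (e * q e)))) / e^2" for e
    using mult.hyps(1-3) by (simp add: wW power2_eq_square)
  ultimately show ?case by simp
next
  case (add d f g)
  then show ?case
    using tendsto_add[OF add.IH] by (simp add: add_divide_distrib)
qed simp

lemma cubic_at_centre: "cubic d r \<Longrightarrow> r (aff 0 0) = 0"
  by (induction rule: cubic.induct) (auto simp: w_aff)

end

section \<open>The osculating space\<close>

lemma peval_forms_1_scale: "f \<in> forms I 1 \<Longrightarrow> peval f (\<lambda>i. c * u i) = c * peval f u"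
  using peval_forms_1_linear[where N = "{()}" and c = "\<lambda>_. c" and t = "\<lambda>_. u"] by simp

lemma veronese_vec_scale: "veronese_vec d (\<lambda>i. c * v i) = (\<lambda>\<alpha>. c ^ d * veronese_vec d v \<alpha>)"
  by (auto simp: veronese_vec_def monomials_def meval_def mdeg_def fun_eq_iff
      power_mult_distrib prod.distrib power_sum)

lemma ex_complex_root:
  fixes c :: complex
  assumes "d > 0"
  shows "\<exists>b. b ^ d = c"
proof -
  have "rcis (root d (cmod c)) (Arg c / d) ^ d = c"
    using assms by (simp add: DeMoivre2 rcis_cmod_Arg)
  then show ?thesis ..
qed

text \<open>Since roots exist, every representative of a point of the surface, and not only one up to
  a scalar, is of the form \<open>veronese_vec d u\<close>; so no homogeneity is needed to test vanishing.\<close>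

lemma veronese_surface_representative:
  assumes "p \<in> veronese_surface d" "v \<in> p" "d > 0"
  shows "\<exists>u. v = veronese_vec d u"
proof -
  obtain u where "p = point (veronese_vec d u)"
    using assms(1) by (auto simp: veronese_surface_def proj_space_def veronese_point)
  then obtain c where v: "v = (\<lambda>\<alpha>. c * veronese_vec d u \<alpha>)"
    using assms(2) by (auto simp: point_def)
  obtain b where "b ^ d = c"
    using ex_complex_root[OF assms(3)] by blast
  then have "v = veronese_vec d (\<lambda>i. b * u i)"
    by (simp add: v veronese_vec_scale)
  then show ?thesis by blast
qed

section \<open>Elements of the cube of an ideal\<close>

lemma cube_eq:
  "J [^]\<^bsub>ideals_set R\<^esub> (3::nat) = ((carrier R \<cdot>\<^bsub>R\<^esub> J) \<cdot>\<^bsub>R\<^esub> J) \<cdot>\<^bsub>R\<^esub> J"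
  by (simp add: nat_pow_def ideals_set_def numeral_3_eq_3)

lemma poly_ring_ops:
  "f \<oplus>\<^bsub>poly_ring I\<^esub> g = f + g" "f \<otimes>\<^bsub>poly_ring I\<^esub> g = f * g" "1 \<in> carrier (poly_ring I)"
  by (simp_all add: poly_ring_def)

lemma mult_in_cube:
  assumes "A \<in> J" "B \<in> J" "C \<in> J"
  shows "A * B * C \<in> J [^]\<^bsub>ideals_set (poly_ring I)\<^esub> (3::nat)"
proof -
  \<comment> \<open>Powers of ideals start from the unit ideal, so the cube is a fourfold product;
    its first factor is filled with 1.\<close>
  have "1 * A * B * C \<in> J [^]\<^bsub>ideals_set (poly_ring I)\<^esub> (3::nat)"
    unfolding cube_eq poly_ring_ops(2)[where I = I, symmetric]
    by (intro ideal_prod.prod assms poly_ring_ops(3))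
  then show ?thesis by simp
qed

lemma add_in_cube:
  assumes "f \<in> J [^]\<^bsub>ideals_set (poly_ring I)\<^esub> (3::nat)" "g \<in> J [^]\<^bsub>ideals_set (poly_ring I)\<^esub> (3::nat)"
  shows "f + g \<in> J [^]\<^bsub>ideals_set (poly_ring I)\<^esub> (3::nat)"
  using assms unfolding cube_eq poly_ring_ops(1)[where I = I, symmetric] by (rule ideal_prod.sum)

context chart
begin

text \<open>Only restrictions to the cone over the surface are recorded, so the witness
  \<open>K\<close> matters up to forms vanishing there. Its membership in the carrier is kept so
  that \<open>K\<close> can be subtracted later.\<close>

definition cube_fun :: "nat \<Rightarrow> ((nat \<Rightarrow> complex) \<Rightarrow> complex) \<Rightarrow> bool" where
  "cube_fun d f \<longleftrightarrow> (\<exists>K \<in> carrier (poly_ring (veronese_coords d)).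
     K \<in> vanishing_ideal (veronese_coords d) {point (veronese_vec d x)}
         [^]\<^bsub>ideals_set (poly_ring (veronese_coords d))\<^esub> (3::nat)
     \<and> (\<forall>v. peval K (veronese_vec d v) = f v))"

lemma cube_fun_add: "cube_fun d f \<Longrightarrow> cube_fun d g \<Longrightarrow> cube_fun d (\<lambda>v. f v + g v)"
  unfolding cube_fun_def by (metis add_in_cube poly_ring_closed(1) peval_add)

text \<open>The linear factor \<open>w i\<close>, filled up to degree \<open>d = Suc n\<close>, is
  the restriction of a linear form, which lies in the ideal of the image point because
  \<open>w i\<close> vanishes at \<open>x\<close>.\<close>

lemma ex_linform_vanishing:
  assumes "i \<in> {k, m}" "form_fun n f"
  obtains L where "L \<in> vanishing_ideal (veronese_coords (Suc n)) {point (veronese_vec (Suc n) x)}"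
    "L \<in> carrier (poly_ring (veronese_coords (Suc n)))"
    "\<And>v. peval L (veronese_vec (Suc n) v) = w i v * f v"
proof -
  let ?I = "veronese_coords (Suc n)"
  obtain c where c: "\<And>v. peval (linform ?I c) (veronese_vec (Suc n) v) = w i v * f v"
    using form_fun_linform[OF form_fun_w_mult[OF assms]] by blast
  have carrier: "linform ?I c \<in> carrier (poly_ring ?I)"
    using linform_in_forms forms_subset_carrier by blast
  have "w i x = 0"
    by (simp add: w_def x_j)
  then have "linform ?I c \<in> vanishing_ideal ?I {point (veronese_vec (Suc n) x)}"
    using carrier
    by (auto simp: vanishing_ideal_def vanishes_def point_def c
        peval_forms_1_scale[OF linform_in_forms])
  then show ?thesis
    using carrier c that by blast
qed

lemma cube_fun_mult:
  assumes "i1 \<in> {k, m}" "i2 \<in> {k, m}" "i3 \<in> {k, m}"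
    and "form_fun n A" "form_fun n B" "form_fun n C"
  shows "cube_fun (Suc n) (\<lambda>v. (w i1 v * A v) * (w i2 v * B v) * (w i3 v * C v))"
proof -
  let ?I = "veronese_coords (Suc n)"
  let ?J = "vanishing_ideal ?I {point (veronese_vec (Suc n) x)}"
  obtain L1 where L1: "L1 \<in> ?J" "L1 \<in> carrier (poly_ring ?I)"
      "\<And>v. peval L1 (veronese_vec (Suc n) v) = w i1 v * A v"
    using ex_linform_vanishing[OF assms(1,4)] by blast
  obtain L2 where L2: "L2 \<in> ?J" "L2 \<in> carrier (poly_ring ?I)"
      "\<And>v. peval L2 (veronese_vec (Suc n) v) = w i2 v * B v"
    using ex_linform_vanishing[OF assms(2,5)] by blast
  obtain L3 where L3: "L3 \<in> ?J" "L3 \<in> carrier (poly_ring ?I)"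
      "\<And>v. peval L3 (veronese_vec (Suc n) v) = w i3 v * C v"
    using ex_linform_vanishing[OF assms(3,6)] by blast
  show ?thesis
    unfolding cube_fun_def
  proof (intro bexI[of _ "L1 * L2 * L3"] conjI allI)
    show "L1 * L2 * L3 \<in> ?J [^]\<^bsub>ideals_set (poly_ring ?I)\<^esub> (3::nat)"
      by (rule mult_in_cube[OF L1(1) L2(1) L3(1)])
    show "L1 * L2 * L3 \<in> carrier (poly_ring ?I)"
      by (intro poly_ring_closed L1 L2 L3)
  qed (simp add: peval_mult L1(3) L2(3) L3(3))
qed

text \<open>
  The cube of the ideal needs three factors of degree \<open>d\<close>, but \<open>r\<close> has only degree \<open>d\<close> in all.
  Multiplied by \<open>g\<close> of degree \<open>2 * d\<close>, its three linear factors can be put into separate forms of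
  degree \<open>d\<close>.  This is why the saturation is needed.
\<close>

lemma cubic_imp_cube_fun:
  "cubic d r \<Longrightarrow> form_fun (2 * d) g \<Longrightarrow> cube_fun d (\<lambda>v. r v * g v)"
proof (induction rule: cubic.induct)
  case (zero d)
  have "0 * 0 * 0 \<in> vanishing_ideal (veronese_coords d) {point (veronese_vec d x)}
         [^]\<^bsub>ideals_set (poly_ring (veronese_coords d))\<^esub> (3::nat)"
    by (intro mult_in_cube)
      (simp_all add: vanishing_ideal_def vanishes_def peval_0 poly_ring_def)
  moreover have "0 \<in> carrier (poly_ring (veronese_coords d))"
    by (simp add: poly_ring_def)
  ultimately show ?case
    unfolding cube_fun_def by (intro bexI[of _ 0]) (simp_all add: peval_0)
next
  case (mult i1 i2 i3 n h)
  let ?n = "Suc (Suc n)"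
  \<comment> \<open>\<open>inner\<close> treats a fixed first factor \<open>A\<close> and splits the
    rest into products \<open>B * C\<close>; \<open>outer\<close> then splits off \<open>A\<close>
    itself.\<close>
  have inner: "cube_fun (Suc ?n) (\<lambda>v. (w i1 v * A v) * (w i2 v * (w i3 v * f v)))"
    if A: "form_fun ?n A" and "prod_span ?n ?n f" for A f
    using that(2)
  proof (induction rule: prod_span.induct)
    case (prod B C)
    show ?case
      using cube_fun_mult[OF mult.hyps(1-3) A prod] by (simp add: algebra_simps)
  next
    case (add f f')
    then show ?case
      using cube_fun_add[OF add.IH] by (simp add: algebra_simps)
  qed
  have outer: "cube_fun (Suc ?n) (\<lambda>v. w i1 v * (w i2 v * (w i3 v * f v)))"
    if "prod_span ?n (?n + ?n) f" for f
    using that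
  proof (induction rule: prod_span.induct)
    case (prod A f)
    show ?case
      using inner[OF prod(1) form_fun_split[OF prod(2)]] by (simp add: algebra_simps)
  next
    case (add f f')
    then show ?case
      using cube_fun_add[OF add.IH] by (simp add: algebra_simps)
  qed
  have "form_fun (n + 2 * Suc ?n) (\<lambda>v. h v * g v)"
    by (rule form_fun_mult[OF mult.hyps(4) mult.prems])
  \<comment> \<open>With \<open>d = n + 3\<close> the cofactor has degree
    \<open>n + 2 * d = 3 * (d - 1)\<close>, so each linear factor receives a form of degree
    \<open>d - 1\<close>.\<close>
  then have "form_fun (?n + (?n + ?n)) (\<lambda>v. h v * g v)"
    by (rule back_subst[of "\<lambda>a. form_fun a (\<lambda>v. h v * g v)"]) simp
  from outer[OF form_fun_split[OF this]] show ?case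
    by (simp add: mult.assoc)
next
  case (add d r r')
  then show ?case
    using cube_fun_add[of d "\<lambda>v. r v * g v" "\<lambda>v. r' v * g v"] by (simp add: distrib_right)
qed

lemma cubic_in_saturation:
  assumes "cubic d r" "d > 0" and L: "L \<in> forms (veronese_coords d) 1"
    and "\<And>v. peval L (veronese_vec d v) = r v"
  shows "L \<in> saturation (veronese_coords d)
    (inf_nbhd_ideal (veronese_coords d) 3 (veronese_surface d) (point (veronese_vec d x)))"
proof -
  let ?I = "veronese_coords d"
  let ?X = "veronese_surface d"
  have L_carrier: "L \<in> carrier (poly_ring ?I)"
    using L forms_subset_carrier by blast
  \<comment> \<open>Degree 2 is enough for the saturation: the restriction of \<open>G * L\<close>
    then has degree \<open>3 * d\<close>, the degree of a product of three restricted linear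
    forms.\<close>
  have "G * L \<in> inf_nbhd_ideal ?I 3 ?X (point (veronese_vec d x))" if G: "G \<in> forms ?I 2" for G
  proof -
    have "cube_fun d (\<lambda>v. r v * peval G (veronese_vec d v))"
      by (rule cubic_imp_cube_fun[OF assms(1) form_fun_peval_veronese[OF G]])
    then obtain K where K: "K \<in> carrier (poly_ring ?I)"
      "K \<in> vanishing_ideal ?I {point (veronese_vec d x)} [^]\<^bsub>ideals_set (poly_ring ?I)\<^esub> (3::nat)"
      "\<And>v. peval K (veronese_vec d v) = r v * peval G (veronese_vec d v)"
      unfolding cube_fun_def by blast
    have "G \<in> carrier (poly_ring ?I)"
      using G forms_subset_carrier by blast
    then have "G * L - K \<in> carrier (poly_ring ?I)"
      by (intro poly_ring_closed L_carrier K(1))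
    \<comment> \<open>\<open>G * L\<close> and \<open>K\<close> agree on the surface, so their
      difference lies in its ideal.\<close>
    moreover have "peval (G * L - K) v = 0" if v: "p \<in> ?X" "v \<in> p" for p v
    proof -
      obtain u where "v = veronese_vec d u"
        using veronese_surface_representative[OF v assms(2)] by blast
      then show ?thesis
        by (simp add: diff_conv_add_uminus peval_add peval_uminus peval_mult assms(4) K(3)
            del: add_uminus_conv_diff)
    qed
    ultimately have "G * L - K \<in> vanishing_ideal ?I ?X"
      by (simp add: vanishing_ideal_def vanishes_def)
    moreover have "G * L = (G * L - K) \<oplus>\<^bsub>poly_ring ?I\<^esub> K"
      by (simp add: poly_ring_ops)
    ultimately show ?thesis
      unfolding inf_nbhd_ideal_def set_add_def' using K(2) by blast
  qed
  then show ?thesis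
    unfolding saturation_def using L_carrier by blast
qed

text \<open>As a linear functional on forms of degree \<open>d\<close>, \<open>t\<close> kills those
  vanishing to order 3, so only Taylor coefficients up to order 2 contribute. The six constants are
  the values of \<open>t\<close> on the six products in the expansion.\<close>

lemma osculating_space_coords:
  assumes T: "T \<in> osculating_space (veronese_coords d) 2 (veronese_surface d) (point (veronese_vec d x))"
    and t: "t \<in> T" and "d \<ge> 2"
  obtains a l1 l2 q11 q12 q22 where
    "\<And>\<alpha> c c1 c2 c11 c12 c22 r. \<alpha> \<in> veronese_coords d
      \<Longrightarrow> expansion d (meval \<alpha>) c c1 c2 c11 c12 c22 r
      \<Longrightarrow> t \<alpha> = c * a + c1 * l1 + c2 * l2 + c11 * q11 + c12 * q12 + c22 * q22"
proof -
  let ?I = "veronese_coords d"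
  have fin: "finite ?I"
    by (rule card_veronese_coords)
  have T': "T \<in> scheme_span ?I
      (inf_nbhd_ideal ?I 3 (veronese_surface d) (point (veronese_vec d x)))"
    using T by (simp add: osculating_space_def)
  have d: "d > 0" "d = Suc (d - 1)" "d - 1 = Suc (d - 2)"
    using assms(3) by auto
  have s: "form_fun n (\<lambda>v. v j ^ n)" for n
    by (rule form_fun_var_power[OF index_le(1)])
  have w1: "form_fun d (\<lambda>v. w i v * v j ^ (d - 1))" if "i \<in> {k, m}" for i
    using form_fun_w_mult[OF that s] d(2) by metis
  have w2: "form_fun d (\<lambda>v. w i v * (w i' v * v j ^ (d - 2)))"
    if "i \<in> {k, m}" "i' \<in> {k, m}" for i i'
    using form_fun_w_mult[OF that(1) form_fun_w_mult[OF that(2) s]] d(2,3) by metis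
  have ex: "\<exists>b. \<forall>v. f v = (\<Sum>\<beta>\<in>?I. b \<beta> * veronese_vec d v \<beta>)" if "form_fun d f" for f
    using form_fun_coeffs[OF that] by (simp add: veronese_vec_def)
  obtain b0 where b0: "\<And>v. v j ^ d = (\<Sum>\<beta>\<in>?I. b0 \<beta> * veronese_vec d v \<beta>)"
    using ex[OF s] by blast
  obtain b1 where b1: "\<And>v. w k v * v j ^ (d - 1) = (\<Sum>\<beta>\<in>?I. b1 \<beta> * veronese_vec d v \<beta>)"
    using ex[OF w1[of k]] by blast
  obtain b2 where b2: "\<And>v. w m v * v j ^ (d - 1) = (\<Sum>\<beta>\<in>?I. b2 \<beta> * veronese_vec d v \<beta>)"
    using ex[OF w1[of m]] by blast
  obtain b11 where b11: "\<And>v. w k v * (w k v * v j ^ (d - 2)) = (\<Sum>\<beta>\<in>?I. b11 \<beta> * veronese_vec d v \<beta>)"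
    using ex[OF w2[of k k]] by blast
  obtain b12 where b12: "\<And>v. w k v * (w m v * v j ^ (d - 2)) = (\<Sum>\<beta>\<in>?I. b12 \<beta> * veronese_vec d v \<beta>)"
    using ex[OF w2[of k m]] by blast
  obtain b22 where b22: "\<And>v. w m v * (w m v * v j ^ (d - 2)) = (\<Sum>\<beta>\<in>?I. b22 \<beta> * veronese_vec d v \<beta>)"
    using ex[OF w2[of m m]] by blast
  define S where "S b = (\<Sum>\<beta>\<in>?I. b \<beta> * t \<beta>)" for b
  show ?thesis
  proof (rule that[of "S b0" "S b1" "S b2" "S b11" "S b12" "S b22"])
    fix \<alpha> c c1 c2 c11 c12 c22 r
    assume \<alpha>: "\<alpha> \<in> ?I" and e: "expansion d (meval \<alpha>) c c1 c2 c11 c12 c22 r"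
    \<comment> \<open>The coordinate at \<open>\<alpha>\<close> minus its Taylor part of order at
      most 2: restricted to the surface, only the remainder \<open>r\<close> is left.\<close>
    define L where "L = linform ?I (\<lambda>\<beta>. of_bool (\<beta> = \<alpha>) - (c * b0 \<beta> + c1 * b1 \<beta> + c2 * b2 \<beta>
      + c11 * b11 \<beta> + c12 * b12 \<beta> + c22 * b22 \<beta>))"
    have peval_L: "peval L u = u \<alpha> - (c * (\<Sum>\<beta>\<in>?I. b0 \<beta> * u \<beta>) + c1 * (\<Sum>\<beta>\<in>?I. b1 \<beta> * u \<beta>)
      + c2 * (\<Sum>\<beta>\<in>?I. b2 \<beta> * u \<beta>) + c11 * (\<Sum>\<beta>\<in>?I. b11 \<beta> * u \<beta>)
      + c12 * (\<Sum>\<beta>\<in>?I. b12 \<beta> * u \<beta>) + c22 * (\<Sum>\<beta>\<in>?I. b22 \<beta> * u \<beta>))" for u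
    proof -
      have "(\<Sum>\<beta>\<in>?I. of_bool (\<beta> = \<alpha>) * u \<beta>) = u \<alpha>"
        using \<alpha> fin by (simp add: of_bool_def if_distrib[of "\<lambda>z. z * _"] cong: if_cong)
      then show ?thesis
        by (simp add: L_def peval_linform left_diff_distrib distrib_right sum_subtractf sum.distrib
            sum_distrib_left mult.assoc)
    qed
    have "L \<in> forms ?I 1"
      unfolding L_def by (rule linform_in_forms)
    moreover have "peval L (veronese_vec d v) = r v" for v
    proof -
      have "veronese_vec d v \<alpha> = meval \<alpha> v"
        using \<alpha> by (simp add: veronese_vec_def)
      then show ?thesis
        unfolding peval_L b0[symmetric] b1[symmetric] b2[symmetric] b11[symmetric] b12[symmetric]
          b22[symmetric]
        using e by (simp add: expansion_def)
    qed
    moreover have "cubic d r"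
      using e by (simp add: expansion_def)
    ultimately have "L \<in> saturation ?I
        (inf_nbhd_ideal ?I 3 (veronese_surface d) (point (veronese_vec d x))) \<inter> forms ?I 1"
      using cubic_in_saturation[OF _ d(1)] by blast
    then have "vanishes L T"
      using T' unfolding scheme_span_def zero_locus_def by blast
    then have "peval L t = 0"
      using t by (simp add: vanishes_def)
    then show "t \<alpha> = c * S b0 + c1 * S b1 + c2 * S b2 + c11 * S b11 + c12 * S b12 + c22 * S b22"
      by (simp add: peval_L S_def)
  qed
qed

end

text \<open>The factors 2 match the second difference
  \<open>(y1 + z1)^2 - y1^2 - z1^2 = 2 * y1 * z1\<close>, and likewise for the second
  coordinate.\<close>

lemma binary_quadratic_form_splits:
  fixes q11 q12 q22 :: complex
  obtains y1 y2 z1 z2 where "2 * y1 * z1 = q11" "y1 * z2 + y2 * z1 = q12" "2 * y2 * z2 = q22"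
proof (cases "q11 = 0")
  case False
  \<comment> \<open>A root of the discriminant of
    \<open>q11 / 2 * X^2 + q12 * X * Y + q22 / 2 * Y^2\<close>; the factors are normalised by
    \<open>y1 = 1\<close>.\<close>
  define s where "s = csqrt (q12^2 - q11 * q22)"
  have s: "s * s = q12 * q12 - q11 * q22"
    using power2_csqrt[of "q12^2 - q11 * q22"] by (simp add: s_def power2_eq_square)
  define y2 where "y2 = (q12 + s) / q11"
  define z2 where "z2 = (q12 - s) / 2"
  have "2 * y2 * z2 = (q12 * q12 - s * s) / q11"
    by (simp add: y2_def z2_def algebra_simps diff_divide_distrib)
  then have "2 * y2 * z2 = q22"
    using False by (simp add: s)
  moreover have "1 * z2 + y2 * (q11 / 2) = q12"
    using False by (simp add: y2_def z2_def field_simps)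
  ultimately show ?thesis
    using that[of 1 "q11 / 2" z2 y2] by simp
next
  case q11: True
  show ?thesis
  proof (cases "q12 = 0")
    case True
    then show ?thesis
      using that[of 0 0 "q22 / 2" 1] q11 by simp
  next
    case False
    then show ?thesis
      using that[of 0 1 "q22 / (2 * q12)" q12] q11 by simp
  qed
qed

context chart
begin

text \<open>
  With \<open>y * z\<close> the quadratic part of the point and \<open>l\<close> its linear part, the second difference with
  steps \<open>e * y\<close> and \<open>e * z\<close> gives the quadratic part; moving the vertex opposite to the
  centre by \<open>e\<^sup>2 * l\<close> adds the linear part without a fifth point.
\<close>

lemma tendsto_four_points:
  assumes "d \<ge> 2"
    and outside: "\<And>\<alpha>. \<alpha> \<notin> veronese_coords d \<Longrightarrow> t \<alpha> = 0"
    and inside: "\<And>\<alpha> c c1 c2 c11 c12 c22 r. \<alpha> \<in> veronese_coords d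
      \<Longrightarrow> expansion d (meval \<alpha>) c c1 c2 c11 c12 c22 r
      \<Longrightarrow> t \<alpha> = c * a + c1 * l1 + c2 * l2 + c11 * q11 + c12 * q12 + c22 * q22"
    and q: "2 * y1 * z1 = q11" "y1 * z2 + y2 * z1 = q12" "2 * y2 * z2 = q22"
  shows "((\<lambda>e. (a + 1 / e^2) * veronese_vec d (aff 0 0) \<alpha>
      + (- 1 / e^2) * veronese_vec d (aff (e * y1) (e * y2)) \<alpha>
      + (- 1 / e^2) * veronese_vec d (aff (e * z1) (e * z2)) \<alpha>
      + (1 / e^2) * veronese_vec d (aff (e * (y1 + z1 + e * l1)) (e * (y2 + z2 + e * l2))) \<alpha>)
    \<longlongrightarrow> t \<alpha>) (at 0)"
    (is "(?f \<longlongrightarrow> _) _")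
proof (cases "\<alpha> \<in> veronese_coords d")
  case False
  then show ?thesis
    by (simp add: veronese_vec_def outside)
next
  case True
  obtain c c1 c2 c11 c12 c22 r where e: "expansion d (meval \<alpha>) c c1 c2 c11 c12 c22 r"
    using ex_expansion[OF form_fun_meval[OF True] assms(1)] by blast
  then have r: "cubic d r"
    by (simp add: expansion_def)
  have val: "veronese_vec d (aff p q) \<alpha> =
      c + c1 * p + c2 * q + c11 * p^2 + c12 * p * q + c22 * q^2 + r (aff p q)" for p q
  proof -
    have "w k (aff p q) = p" "w m (aff p q) = q"
      using indices by (simp_all add: w_aff)
    then show ?thesis
      using e True by (simp add: expansion_def veronese_vec_def power2_eq_square)
  qed
  let ?R = "\<lambda>p q e. r (aff (e * p e) (e * q e)) / e^2"
  let ?p = "\<lambda>e. y1 + z1 + e * l1" and ?q = "\<lambda>e. y2 + z2 + e * l2"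
  \<comment> \<open>The combination after cancellation: the weights sum to \<open>a\<close>, the
    linear terms leave \<open>l1\<close> and \<open>l2\<close>, and the quadratic terms lose their
    factor \<open>e^2\<close>.\<close>
  let ?g = "\<lambda>e. c * a + c1 * l1 + c2 * l2
      + c11 * ((?p e)^2 - y1^2 - z1^2) + c12 * (?p e * ?q e - y1 * y2 - z1 * z2)
      + c22 * ((?q e)^2 - y2^2 - z2^2)
      + (?R ?p ?q e - ?R (\<lambda>_. y1) (\<lambda>_. y2) e - ?R (\<lambda>_. z1) (\<lambda>_. z2) e)"
  have R: "(?R p q \<longlongrightarrow> 0) (at 0)" if "(p \<longlongrightarrow> p0) (at 0)" "(q \<longlongrightarrow> q0) (at 0)" for p q p0 q0
    by (rule tendsto_cubic[OF r that])
  have p: "(?p \<longlongrightarrow> y1 + z1 + 0 * l1) (at 0)" and q': "(?q \<longlongrightarrow> y2 + z2 + 0 * l2) (at 0)"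
    by (intro tendsto_intros)+
  have "(?g \<longlongrightarrow> c * a + c1 * l1 + c2 * l2
      + c11 * ((y1 + z1 + 0 * l1)^2 - y1^2 - z1^2)
      + c12 * ((y1 + z1 + 0 * l1) * (y2 + z2 + 0 * l2) - y1 * y2 - z1 * z2)
      + c22 * ((y2 + z2 + 0 * l2)^2 - y2^2 - z2^2) + (0 - 0 - 0)) (at 0)"
    by (intro tendsto_add tendsto_diff tendsto_mult tendsto_power tendsto_const p q'
        R[OF p q'] R[OF tendsto_const tendsto_const] tendsto_ident_at)
  moreover have "c * a + c1 * l1 + c2 * l2
      + c11 * ((y1 + z1 + 0 * l1)^2 - y1^2 - z1^2)
      + c12 * ((y1 + z1 + 0 * l1) * (y2 + z2 + 0 * l2) - y1 * y2 - z1 * z2)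
      + c22 * ((y2 + z2 + 0 * l2)^2 - y2^2 - z2^2) + (0 - 0 - 0) = t \<alpha>"
    unfolding inside[OF True e] q[symmetric] by (simp add: power2_eq_square algebra_simps)
  moreover have "?g e = ?f e" if "e \<noteq> 0" for e
    unfolding val cubic_at_centre[OF r]
    using that by (simp add: field_simps power2_eq_square)
  then have "\<forall>\<^sub>F e in at 0. ?g e = ?f e"
    by (auto simp: eventually_at_filter)
  ultimately show ?thesis
    using tendsto_cong by force
qed

end

section \<open>The secant variety\<close>

lemma mem_point: "v \<in> point v"
  unfolding point_def by (intro CollectI exI[of _ 1]) auto

lemma point_eq: "t \<in> point u \<Longrightarrow> point t = point u"
proof -
  assume "t \<in> point u"
  then obtain c where c: "c \<noteq> 0" "t = (\<lambda>i. c * u i)"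
    by (auto simp: point_def)
  show "point t = point u"
  proof
    show "point t \<subseteq> point u"
    proof
      fix v assume "v \<in> point t"
      then obtain b where "b \<noteq> 0" "v = (\<lambda>i. b * t i)"
        by (auto simp: point_def)
      then show "v \<in> point u"
        using c unfolding point_def by (intro CollectI exI[of _ "b * c"]) auto
    qed
    show "point u \<subseteq> point t"
    proof
      fix v assume "v \<in> point u"
      then obtain b where "b \<noteq> 0" "v = (\<lambda>i. b * u i)"
        by (auto simp: point_def)
      then show "v \<in> point t"
        using c unfolding point_def by (intro CollectI exI[of _ "b / c"]) auto
    qed
  qed
qed

text \<open>\<open>open_secant\<close> asks for exactly \<open>k\<close> distinct points, so smaller
  sets have to be padded. The images of the points \<open>(1, s, 0)\<close> differ because two of
  their coordinates are 1 and \<open>s\<close>.\<close>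

lemma infinite_veronese_surface:
  assumes "d > 0"
  shows "infinite (veronese_surface d)"
proof -
  define u :: "complex \<Rightarrow> nat \<Rightarrow> complex"
    where "u s i = (if i = 0 then 1 else if i = 1 then s else 0)" for s i
  have "point (u s) \<in> plane" for s
    unfolding proj_space_def by (intro imageI CollectI conjI exI[of _ 0]) (auto simp: u_def)
  then have "range (\<lambda>s. veronese d (point (u s))) \<subseteq> veronese_surface d"
    by (auto simp: veronese_surface_def)
  moreover have "inj (\<lambda>s. veronese d (point (u s)))"
  proof (rule injI)
    fix s s' assume "veronese d (point (u s)) = veronese d (point (u s'))"
    then have "veronese_vec d (u s) \<in> point (veronese_vec d (u s'))"
      using mem_point by (auto simp: veronese_point)
    then obtain c where c: "\<And>\<alpha>. veronese_vec d (u s) \<alpha> = c * veronese_vec d (u s') \<alpha>"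
      by (auto simp: point_def dest: fun_cong)
    let ?a = "Poly_Mapping.single (0::nat) d"
      and ?b = "Poly_Mapping.single (0::nat) (d - 1) + Poly_Mapping.single 1 (1::nat)"
    have a: "?a \<in> veronese_coords d"
      by (auto simp: monomials_def mdeg_def)
    have b: "?b \<in> veronese_coords d"
    proof -
      have k: "Poly_Mapping.keys ?b \<subseteq> {..2}"
        using keys_add[of "Poly_Mapping.single (0::nat) (d - 1)" "Poly_Mapping.single 1 (1::nat)"]
        by (auto split: if_splits)
      then show ?thesis
        using assms mdeg_superset[OF _ k]
        by (simp add: monomials_def lookup_add lookup_single numeral_2_eq_2)
    qed
    have "veronese_vec d (u s) ?a = 1" "veronese_vec d (u s) ?b = s" for s
      using a b by (simp_all add: veronese_vec_def meval_single meval_add u_def)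
    then show "s = s'"
      using c[of ?a] c[of ?b] by simp
  qed
  ultimately show ?thesis
    using infinite_UNIV_char_0[where 'a = complex] finite_imageD finite_subset by blast
qed

text \<open>The \<open>u i\<close> may give coinciding points, as the four points do when
  \<open>y\<close> or \<open>z\<close> is zero. Fresh points of the surface bring the set to size
  \<open>n\<close> without shrinking the span.\<close>

lemma point_in_open_secant:
  assumes "d > 0" "finite N" "card N \<le> n"
    and u: "\<And>i. i \<in> N \<Longrightarrow> point (u i) \<in> plane"
    and t: "t = (\<lambda>\<alpha>. \<Sum>i\<in>N. b i * veronese_vec d (u i) \<alpha>)" and "t \<beta> \<noteq> 0"
  shows "point t \<in> open_secant (veronese_coords d) n (veronese_surface d)"
proof -
  let ?I = "veronese_coords d"
  let ?X = "veronese_surface d"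
  define P where "P = (\<lambda>i. point (veronese_vec d (u i))) ` N"
  have P: "P \<subseteq> ?X" "finite P" "card P \<le> n"
    using u assms(2,3) card_image_le[OF assms(2)]
    by (auto simp: P_def veronese_surface_def simp flip: veronese_point intro: order_trans)
  have "infinite (?X - P)"
    using infinite_veronese_surface[OF assms(1)] P(2) by simp
  then obtain Q where Q: "finite Q" "card Q = n - card P" "Q \<subseteq> ?X - P"
    using infinite_arbitrarily_large by blast
  then have "card (P \<union> Q) = n"
    using P by (subst card_Un_disjoint) auto
  moreover have "point t \<in> proj_span ?I (P \<union> Q)"
    unfolding proj_span_def hull_def
  proof (intro InterI, clarify)
    fix W assume W: "linear_subspace ?I W" "P \<union> Q \<subseteq> W"
    then obtain A where A: "A \<subseteq> forms ?I 1" "W = zero_locus ?I A"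
      by (auto simp: linear_subspace_def)
    have "t \<alpha> = 0" if "\<alpha> \<notin> ?I" for \<alpha>
      using that by (simp add: t veronese_vec_def)
    then have "point t \<in> proj_space ?I"
      unfolding proj_space_def using assms(6) by blast
    moreover have "vanishes f (point t)" if f: "f \<in> A" for f
    proof -
      have f1: "f \<in> forms ?I 1"
        using A(1) f by blast
      have "peval f (veronese_vec d (u i)) = 0" if "i \<in> N" for i
      proof -
        have "point (veronese_vec d (u i)) \<in> W"
          using W(2) that by (auto simp: P_def)
        then show ?thesis
          using f mem_point by (auto simp: A(2) zero_locus_def vanishes_def)
      qed
      then have "peval f t = 0"
        by (simp add: t peval_forms_1_linear[OF f1])
      then show ?thesis
        by (auto simp: vanishes_def point_def peval_forms_1_scale[OF f1])
    qed
    ultimately show "point t \<in> W"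
      by (simp add: A(2) zero_locus_def)
  qed
  ultimately show ?thesis
    unfolding open_secant_def using P Q by blast
qed

text \<open>Stated for every closed \<open>Z\<close> containing the open secants, since the secant
  variety is the intersection of all of these.\<close>

lemma osculating_space_subset:
  assumes "d \<ge> 2" "p \<in> veronese_surface d"
    and closed: "zariski_closed (veronese_coords d) Z"
    and secant: "open_secant (veronese_coords d) 4 (veronese_surface d) \<subseteq> Z"
  shows "osculating_space (veronese_coords d) 2 (veronese_surface d) p \<subseteq> Z"
proof
  let ?I = "veronese_coords d"
  fix T assume T: "T \<in> osculating_space ?I 2 (veronese_surface d) p"
  obtain A where A: "Z = zero_locus ?I A"
    using closed by (auto simp: zariski_closed_def)
  obtain u j where u: "p = point (veronese_vec d u)" "\<And>i. i \<notin> {..2} \<Longrightarrow> u i = 0" "u j \<noteq> 0"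
    using assms(2) by (auto simp: veronese_surface_def proj_space_def veronese_point)
  have "{..2::nat} = {0, 1, 2}" "j \<in> {..2}"
    using u(2,3) by auto
  then obtain k m where indices: "{..2} = {j, k, m}" "j \<noteq> k" "j \<noteq> m" "k \<noteq> m"
  proof -
    assume *: "\<And>k m. {..2} = {j, k, m} \<Longrightarrow> j \<noteq> k \<Longrightarrow> j \<noteq> m \<Longrightarrow> k \<noteq> m \<Longrightarrow> thesis"
    have "j = 0 \<or> j = 1 \<or> j = 2"
      using \<open>{..2} = {0, 1, 2}\<close> \<open>j \<in> {..2}\<close> by blast
    then show thesis
      using *[of 1 2] *[of 0 2] *[of 0 1] \<open>{..2} = {0, 1, 2}\<close> by (elim disjE) auto
  qed
  \<comment> \<open>Scaling by the nonzero coordinate \<open>j\<close> reaches the chart without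
    changing the point.\<close>
  define x where "x i = (1 / u j) * u i" for i
  interpret chart x j k m
  proof
    show "x j = 1" "\<And>i. i \<notin> {..2} \<Longrightarrow> x i = 0"
      using u(3) by (simp_all add: x_def u(2))
  qed (fact indices)+
  have "x \<in> point u"
    using u(3) unfolding point_def by (intro CollectI exI[of _ "1 / u j"]) (auto simp: x_def)
  then have "point x = point u"
    by (rule point_eq)
  then have p: "p = point (veronese_vec d x)"
    by (metis u(1) veronese_point)
  have T_proj: "T \<in> proj_space ?I"
    using T by (simp add: osculating_space_def scheme_span_def zero_locus_def)
  have "vanishes f T" if f: "f \<in> A" for f
    unfolding vanishes_def
  proof
    \<comment> \<open>Every representative \<open>t\<close> of \<open>T\<close> is approximated by
      its own curve, so vanishing of \<open>f\<close> is checked on each of them directly.\<close>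
    fix t assume t: "t \<in> T"
    obtain t0 where t0: "T = point t0" "\<And>\<alpha>. \<alpha> \<notin> ?I \<Longrightarrow> t0 \<alpha> = 0" "\<exists>\<alpha>. t0 \<alpha> \<noteq> 0"
      using T_proj by (auto simp: proj_space_def)
    have outside: "t \<alpha> = 0" if "\<alpha> \<notin> ?I" for \<alpha>
      using t t0(2)[OF that] by (auto simp: t0(1) point_def)
    obtain \<beta> where \<beta>: "t \<beta> \<noteq> 0"
      using t t0(3) by (auto simp: t0(1) point_def)
    obtain a l1 l2 q11 q12 q22 where inside:
      "\<And>\<alpha> c c1 c2 c11 c12 c22 r. \<alpha> \<in> ?I \<Longrightarrow> expansion d (meval \<alpha>) c c1 c2 c11 c12 c22 r
        \<Longrightarrow> t \<alpha> = c * a + c1 * l1 + c2 * l2 + c11 * q11 + c12 * q12 + c22 * q22"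
      using osculating_space_coords[OF T[unfolded p] t assms(1)] by blast
    obtain y1 y2 z1 z2 where q: "2 * y1 * z1 = q11" "y1 * z2 + y2 * z1 = q12" "2 * y2 * z2 = q22"
      by (rule binary_quadratic_form_splits)
    define b where "b e = (!) [a + 1 / e^2, - 1 / e^2, - 1 / e^2, 1 / e^2]" for e :: complex
    define v where "v e = (!) [aff 0 0, aff (e * y1) (e * y2), aff (e * z1) (e * z2),
      aff (e * (y1 + z1 + e * l1)) (e * (y2 + z2 + e * l2))]" for e
    define s where "s e = (\<lambda>\<alpha>. \<Sum>i<4. b e i * veronese_vec d (v e i) \<alpha>)" for e
    have s_lim: "((\<lambda>e. s e \<alpha>) \<longlongrightarrow> t \<alpha>) (at 0)" for \<alpha>
      using tendsto_four_points[OF assms(1) outside inside q, where \<alpha> = \<alpha>]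
      by (simp add: s_def b_def v_def eval_nat_numeral)
    have "point (aff y z) \<in> plane" for y z
      using indices x_outside index_le aff_j[of y z] unfolding proj_space_def
      by (intro imageI CollectI conjI exI[of _ j]) (auto simp: aff_def)
    then have v: "point (v e i) \<in> plane" if "i \<in> {..<4}" for e i
      using that by (auto simp: v_def less_Suc_eq eval_nat_numeral)
    \<comment> \<open>Only a nonzero vector defines a projective point; near \<open>e = 0\<close>
      this follows from \<open>t \<beta> \<noteq> 0\<close>.\<close>
    have "\<forall>\<^sub>F e in at 0. s e \<beta> \<noteq> 0"
      using tendsto_imp_eventually_ne[OF s_lim \<beta>] .
    then have "\<forall>\<^sub>F e in at 0. peval f (s e) = 0"
    proof eventually_elim
      case (elim e)
      have "point (s e) \<in> Z"
        using point_in_open_secant[OF _ _ _ v s_def elim, of 4] assms(1) secant by auto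
      then show ?case
        using f mem_point by (auto simp: A zero_locus_def vanishes_def)
    qed
    then have "((\<lambda>e. peval f (s e)) \<longlongrightarrow> 0) (at 0)"
      by (rule tendsto_eventually)
    moreover have "((\<lambda>e. peval f (s e)) \<longlongrightarrow> peval f t) (at 0)"
      by (rule tendsto_peval[OF s_lim])
    ultimately show "peval f t = 0"
      using tendsto_unique[OF at_neq_bot] by blast
  qed
  then show "T \<in> Z"
    using T_proj by (simp add: A zero_locus_def)
qed

theorem corollary4p4:
  fixes d :: nat
  assumes "d \<ge> 2"
  shows "osculating_variety (veronese_coords d) 2 (veronese_surface d)
           \<subseteq> secant_variety (veronese_coords d) 4 (veronese_surface d)
       \<and> (\<forall>T \<in> osculating_variety (veronese_coords d) 2 (veronese_surface d).
            border_rank (veronese_coords d) (veronese_surface d) T \<le> 4)"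
proof -
  \<comment> \<open>Each closed set containing the open secants contains all osculating spaces, so
    the hull on the left is an intersection over a larger family.\<close>
  have sub: "osculating_variety (veronese_coords d) 2 (veronese_surface d)
      \<subseteq> secant_variety (veronese_coords d) 4 (veronese_surface d)"
    unfolding osculating_variety_def secant_variety_def zariski_closure_def hull_def
    using osculating_space_subset[OF assms] by blast
  moreover have "border_rank (veronese_coords d) (veronese_surface d) T \<le> 4"
    if "T \<in> osculating_variety (veronese_coords d) 2 (veronese_surface d)" for T
    unfolding border_rank_def using sub that by (intro Least_le) auto
  ultimately show ?thesis by blast
qed

end
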